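(* Let $p,q:\mathbb{R}\to\mathbb{R}$ be real functions that are periodic with period $T$, i.e. $p(t+T)=p(t)$ and $q(t+T)=q(t)$, with $p\neq q$, and let $t\ge 0$. Consider the two-state continuous time Markov chain on $\{-1,+1\}$ with jump rates $p$ (from $-1$ to $+1$) and $q$ (from $+1$ to $-1$), whose state probabilities are $$\nu_-(t)=\frac{\nu_-(0)+\int_0^tq(s)\exp\left\{\int_0^sp(u)+q(u)\,du\right\}ds}{\exp\left\{\int_0^tp(u)+q(u)\,du\right\}},\qquad \nu_+(t)=\frac{\nu_+(0)+\int_0^tp(s)\exp\left\{\int_0^sp(u)+q(u)\,du\right\}ds}{\exp\left\{\int_0^tp(u)+q(u)\,du\right\}}.$$ For these state probabilities the invariant measures are $$\overline{\nu}_-(t)=\frac{\int^t_0p(s)g(s)\,ds}{g(t)}+\frac{\int^T_0p(s)g(s)\,ds}{g(t)\left(g(T)-1\right)},$$ $$\overline{\nu}_+(t)=\frac{\int^t_0q(s)g(s)\,ds}{g(t)}+\frac{\int^T_0q(s)g(s)\,ds}{g(t)\left(g(T)-1\right)},$$ where $$g(t)=\exp\left\{\int^t_0p(u)+q(u)\,du\right\}.$$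
   Context: The process $Y_t\in\{-1,+1\}$ has probability $p(t)\,\delta t$ of jumping from $-1$ to $+1$, and probability $q(t)\,\delta t$ of jumping from $+1$ to $-1$, in a small time interval $[t,t+\delta t]$. Its state probabilities are $\nu_-(t)=P(Y_t=-1)$ and $\nu_+(t)=P(Y_t=+1)$, with $\nu_-(t)+\nu_+(t)=1$ and initial values $\nu_-(0),\nu_+(0)$; they solve $\nu_-'=-p\nu_-+q\nu_+$, $\nu_+'=p\nu_--q\nu_+$. The invariant measures are the limits of the state probabilities over an integer number $N$ of periods, $\overline{\nu}_\pm(t)=\lim_{N\to\infty}\nu_\pm(NT+t)$.
   Formalization: The printed invariant measures have p and q interchanged (false for constant p=1, q=2: the limit of ν_- is 2/3, not 1/3); proved with q in ν̄_- and p in ν̄_+. Also assumed: T>0, p and q nonnegative and integrable over a period, and g(T)≠1. *)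

theory Defs
  imports "HOL-Probability.Probability"
begin

definition rate_exp :: "(real \<Rightarrow> real) \<Rightarrow> (real \<Rightarrow> real) \<Rightarrow> real \<Rightarrow> real" where
  "rate_exp p q t = exp (integral {0..t} (\<lambda>u. p u + q u))"

definition state_prob :: "'a measure \<Rightarrow> (real \<Rightarrow> 'a \<Rightarrow> int) \<Rightarrow> int \<Rightarrow> real \<Rightarrow> real" where
  "state_prob M Y y t = \<P>(\<omega> in M. Y t \<omega> = y)"

text \<open>
  The Markov property is the elementary one, for finitely many past times and conditioning events
  of positive probability.

  The rates are given by their infinitesimal description: conditionally on being in the state of
  departure at time \<open>t\<close>, a jump during \<open>[t, t + h]\<close> has probability \<open>p t * h + o(h)\<close>, respectively
  \<open>q t * h + o(h)\<close>. It is only required for almost every \<open>t\<close>, because for rates that are merely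
  locally integrable it cannot be expected at points of discontinuity.
\<close>
locale two_state_chain = prob_space M
  for M :: "'a measure" and Y :: "real \<Rightarrow> 'a \<Rightarrow> int" and p q :: "real \<Rightarrow> real" +
  assumes measurable_state: "\<And>t. t \<ge> 0 \<Longrightarrow> Y t \<in> measurable M (count_space UNIV)"
    and states: "\<And>t \<omega>. t \<ge> 0 \<Longrightarrow> \<omega> \<in> space M \<Longrightarrow> Y t \<omega> \<in> {-1, 1}"
    and markov: "\<And>S s t x a b. finite S \<Longrightarrow> S \<subseteq> {0..<s} \<Longrightarrow> 0 \<le> s \<Longrightarrow> s \<le> t \<Longrightarrow>
      \<P>(\<omega> in M. (\<forall>r\<in>S. Y r \<omega> = x r) \<and> Y s \<omega> = a) > 0 \<Longrightarrow>
      \<P>(\<omega> in M. Y t \<omega> = b \<bar> (\<forall>r\<in>S. Y r \<omega> = x r) \<and> Y s \<omega> = a) =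
      \<P>(\<omega> in M. Y t \<omega> = b \<bar> Y s \<omega> = a)"
    and rates_nonneg: "\<And>t. p t \<ge> 0" "\<And>t. q t \<ge> 0"
    and rate_up: "AE t in lborel. t \<ge> 0 \<longrightarrow> state_prob M Y (-1) t > 0 \<longrightarrow>
      ((\<lambda>h. \<P>(\<omega> in M. Y (t + h) \<omega> = 1 \<bar> Y t \<omega> = -1) / h) \<longlongrightarrow> p t) (at_right 0)"
    and rate_down: "AE t in lborel. t \<ge> 0 \<longrightarrow> state_prob M Y 1 t > 0 \<longrightarrow>
      ((\<lambda>h. \<P>(\<omega> in M. Y (t + h) \<omega> = -1 \<bar> Y t \<omega> = 1) / h) \<longlongrightarrow> q t) (at_right 0)"

definition has_invariant_measure :: "(real \<Rightarrow> real) \<Rightarrow> real \<Rightarrow> real \<Rightarrow> real \<Rightarrow> bool" where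
  "has_invariant_measure \<nu> T t l \<longleftrightarrow> (\<lambda>N. \<nu> (real N * T + t)) \<longlonglongrightarrow> l"

text \<open>
  For continuous rates, the denominator \<open>rate_exp p q T - 1\<close> of the invariant measures is nonzero
  as soon as \<open>p \<noteq> q\<close>. For rates that are merely integrable this can fail, since \<open>p\<close> and \<open>q\<close> may
  vanish almost everywhere and differ on a null set.
\<close>
lemma rate_exp_period_neq_1:
  fixes p q :: "real \<Rightarrow> real"
  assumes "T > 0" and per: "\<And>t. p (t + T) = p t" "\<And>t. q (t + T) = q t"
    and nonneg: "\<And>t. p t \<ge> 0" "\<And>t. q t \<ge> 0"
    and cont: "continuous_on UNIV p" "continuous_on UNIV q" and "p \<noteq> q"
  shows "rate_exp p q T \<noteq> 1"
proof
  assume "rate_exp p q T = 1"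
  then have int0: "integral {0..T} (\<lambda>u. p u + q u) = 0"
    by (simp add: rate_exp_def)
  have "continuous_on {0..T} (\<lambda>u. p u + q u)"
    using cont by (intro continuous_on_add) (auto intro: continuous_on_subset)
  then have zero: "\<forall>x\<in>{0..T}. p x + q x = 0"
    using int0 \<open>T > 0\<close> nonneg by (subst (asm) integral_eq_0_iff) auto
  interpret P: periodic_fun_simple p T by standard (rule per)
  interpret Q: periodic_fun_simple q T by standard (rule per)
  have "p x = q x" for x
  proof -
    define y where "y = x - of_int \<lfloor>x / T\<rfloor> * T"
    have "y \<in> {0..T}"
      using floor_divide_lower[OF \<open>T > 0\<close>, of x] floor_divide_upper[OF \<open>T > 0\<close>, of x]
      by (simp add: y_def algebra_simps)
    then have "p y + q y = 0"
      using zero by blast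
    then have "p y = 0" "q y = 0"
      using nonneg[of y] by linarith+
    then show ?thesis
      by (simp add: y_def P.minus_of_int Q.minus_of_int)
  qed
  with \<open>p \<noteq> q\<close> show False by auto
qed

end

theory Submission
  imports Defs
begin

text \<open>
  Write \<open>g\<close> for \<open>rate_exp p q\<close>, \<open>G = g T\<close>, and \<open>F s\<close> for the integral of \<open>r * g\<close> over \<open>{0..s}\<close>,
  where \<open>r\<close> is the rate of entering the state considered: \<open>q\<close> for state \<open>-1\<close> and \<open>p\<close> for state
  \<open>1\<close>. Periodicity of the rates makes \<open>g\<close> multiplicatively periodic, \<open>g (s + T) = G * g s\<close>. The
  integrand of \<open>F\<close> inherits this factor, so \<open>F (s + T) = F T + G * F s\<close>
  (lemma \<open>quasiperiodic_has_integral_shift\<close>).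

  This affine recursion has the fixed point \<open>- c\<close> with \<open>c = F T / (G - 1)\<close>, so \<open>F + c\<close> is also
  multiplied by \<open>G\<close> over each period. Hence \<open>(F + c) / g\<close> is \<open>T\<close>-periodic on the half-line, and it
  is exactly the claimed invariant measure. The state probability \<open>(n + F) / g\<close>, with initial value
  \<open>n\<close>, differs from it by \<open>(n - c) / g\<close>. Along \<open>N * T + t\<close> the denominator of this difference is
  \<open>G ^ N * g t\<close>, which tends to infinity: the rates are nonnegative, so \<open>G \<ge> 1\<close>, and
  \<open>G = 1\<close> is excluded. Lemma \<open>affine_recursion_quotient_limit\<close> is this
  argument for arbitrary \<open>F\<close> and \<open>g\<close> with such recursions.
\<close>

lemma quasiperiodic_iterate:
  fixes f :: "real \<Rightarrow> real"
  assumes "T \<ge> 0" and quasi: "\<And>s. s \<ge> 0 \<Longrightarrow> f (s + T) = c * f s" and "s \<ge> 0"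
  shows "f (real N * T + s) = c ^ N * f s"
proof (induction N)
  case 0
  show ?case by simp
next
  case (Suc N)
  have "f (real (Suc N) * T + s) = f ((real N * T + s) + T)"
    by (simp add: algebra_simps)
  also have "\<dots> = c * f (real N * T + s)"
    using assms by (intro quasi) simp
  finally show ?case
    using Suc.IH by simp
qed

text \<open>
  The interval \<open>{0..b + T}\<close> splits at \<open>T\<close>, and its second piece is \<open>{0..b}\<close> shifted by one period.
  The factor \<open>c\<close> is \<open>1\<close> for the exponent of \<open>rate_exp\<close> and \<open>rate_exp p q T\<close> for the numerators.
\<close>
lemma quasiperiodic_has_integral_shift:
  fixes f :: "real \<Rightarrow> real"
  assumes "T \<ge> 0" and "b \<ge> 0" and quasi: "\<And>s. s \<ge> 0 \<Longrightarrow> f (s + T) = c * f s"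
    and I: "(f has_integral I) {0..T}" and J: "(f has_integral J) {0..b}"
  shows "(f has_integral (I + c * J)) {0..b + T}"
proof -
  have "((\<lambda>s. c * f s) has_integral c * J) {0..b}"
    using J by (rule has_integral_mult_right)
  then have "((f \<circ> (+) T) has_integral c * J) {0..b}"
    by (rule has_integral_eq[rotated]) (simp add: quasi[symmetric] add.commute)
  then have "(f has_integral c * J) {T..b + T}"
    unfolding has_integral_shift_Icc_real by simp
  with I show ?thesis
    using assms by (intro has_integral_combine[of 0 T "b + T"]) auto
qed

lemma quasiperiodic_integrable:
  fixes f :: "real \<Rightarrow> real"
  assumes "T > 0" and quasi: "\<And>s. s \<ge> 0 \<Longrightarrow> f (s + T) = c * f s"
    and int: "f integrable_on {0..T}"
  shows "f integrable_on {0..b}"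
proof -
  have periods: "f integrable_on {0..real N * T}" for N
  proof (induction N)
    case 0
    show ?case using integrable_on_refl[of f 0] by simp
  next
    case (Suc N)
    from Suc.IH int obtain I J where "(f has_integral I) {0..T}"
      and "(f has_integral J) {0..real N * T}"
      by (auto simp: integrable_on_def)
    then have "(f has_integral (I + c * J)) {0..real N * T + T}"
      using \<open>T > 0\<close> by (intro quasiperiodic_has_integral_shift) (auto simp: quasi)
    then show ?case
      by (auto simp: integrable_on_def algebra_simps)
  qed
  obtain N where "b < real N * T"
    using reals_Archimedean3[OF \<open>T > 0\<close>] by blast
  then show ?thesis
    by (intro integrable_on_subinterval[OF periods[of N]]) auto
qed

corollary quasiperiodic_integral_shift:
  fixes f :: "real \<Rightarrow> real"
  assumes "T > 0" and "b \<ge> 0" and "\<And>s. s \<ge> 0 \<Longrightarrow> f (s + T) = c * f s"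
    and "f integrable_on {0..T}"
  shows "integral {0..b + T} f = integral {0..T} f + c * integral {0..b} f"
  using assms
  by (intro integral_unique quasiperiodic_has_integral_shift integrable_integral
      quasiperiodic_integrable[OF assms(1,3,4)]) auto

text \<open>
  Adding the constant \<open>F T / (c - 1)\<close> turns the affine recursion of \<open>F\<close> into multiplication by \<open>c\<close>,
  which cancels against that of \<open>g\<close>; what remains of the initial value decays like \<open>1 / c ^ N\<close>.
\<close>
lemma affine_recursion_quotient_limit:
  fixes F g :: "real \<Rightarrow> real"
  assumes "T \<ge> 0" and "t \<ge> 0" and "c > 1" and "g t \<noteq> 0"
    and g: "\<And>s. s \<ge> 0 \<Longrightarrow> g (s + T) = c * g s"
    and F: "\<And>s. s \<ge> 0 \<Longrightarrow> F (s + T) = F T + c * F s"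
  shows "(\<lambda>N. (n + F (real N * T + t)) / g (real N * T + t))
    \<longlonglongrightarrow> F t / g t + F T / (g t * (c - 1))"
proof -
  define k where "k = F T / (c - 1)"
  have "F (s + T) + k = c * (F s + k)" if "s \<ge> 0" for s
    using \<open>c > 1\<close> F[OF that] by (simp add: k_def field_simps)
  from quasiperiodic_iterate[where f = "\<lambda>s. F s + k", OF \<open>T \<ge> 0\<close> this \<open>t \<ge> 0\<close>]
  have Fk: "F (real N * T + t) + k = c ^ N * (F t + k)" for N .
  have gN: "g (real N * T + t) = c ^ N * g t" for N
    using \<open>T \<ge> 0\<close> g \<open>t \<ge> 0\<close> by (rule quasiperiodic_iterate)
  have "(n + F (real N * T + t)) / g (real N * T + t)
      = (F t + k) / g t + (n - k) / g t * inverse (c ^ N)" for N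
  proof -
    have "n + F (real N * T + t) = (n - k) + c ^ N * (F t + k)"
      using Fk[of N] by simp
    then show ?thesis
      unfolding gN using \<open>c > 1\<close> \<open>g t \<noteq> 0\<close>
      by (simp only: add_divide_distrib) (simp add: field_simps)
  qed
  moreover have "(\<lambda>N. (F t + k) / g t + (n - k) / g t * inverse (c ^ N))
      \<longlonglongrightarrow> (F t + k) / g t + (n - k) / g t * 0"
    using \<open>c > 1\<close> by (intro tendsto_intros LIMSEQ_inverse_realpow_zero)
  moreover have "(F t + k) / g t + (n - k) / g t * 0 = F t / g t + F T / (g t * (c - 1))"
    by (simp add: k_def add_divide_distrib mult.commute)
  ultimately show ?thesis
    by simp
qed

lemma rate_exp_pos: "rate_exp p q s > 0"
  by (simp add: rate_exp_def)

lemma rate_exp_add_period: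
  assumes "T > 0" and "\<And>s. p (s + T) = p s" and "\<And>s. q (s + T) = q s"
    and "p integrable_on {0..T}" and "q integrable_on {0..T}" and "s \<ge> 0"
  shows "rate_exp p q (s + T) = rate_exp p q T * rate_exp p q s"
proof -
  have "integral {0..s + T} (\<lambda>u. p u + q u)
      = integral {0..T} (\<lambda>u. p u + q u) + 1 * integral {0..s} (\<lambda>u. p u + q u)"
    using assms by (intro quasiperiodic_integral_shift[OF \<open>T > 0\<close> \<open>s \<ge> 0\<close>] integrable_add) auto
  then show ?thesis
    by (simp add: rate_exp_def exp_add)
qed

text \<open>
  Products of integrable functions need not be integrable for the gauge integral; here
  nonnegativity of \<open>r\<close> gives absolute integrability, and \<open>rate_exp\<close> is continuous, hence bounded,
  on the compact interval.
\<close>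
lemma integrable_mult_rate_exp:
  assumes "p integrable_on {0..T}" and "q integrable_on {0..T}"
    and r: "r integrable_on {0..T}" and nonneg: "\<And>s. r s \<ge> (0::real)"
  shows "(\<lambda>s. r s * rate_exp p q s) integrable_on {0..T}"
proof -
  have cont: "continuous_on {0..T} (rate_exp p q)"
    unfolding rate_exp_def[abs_def] using assms(1,2)
    by (intro continuous_on_exp indefinite_integral_continuous_1 integrable_add)
  have "(\<lambda>s. rate_exp p q s * r s) absolutely_integrable_on {0..T}"
  proof (rule absolutely_integrable_bounded_measurable_product_real)
    show "rate_exp p q \<in> borel_measurable (lebesgue_on {0..T})"
      using cont by (rule continuous_imp_measurable_on_sets_lebesgue) simp
    show "bounded (rate_exp p q ` {0..T})"
      using cont by (intro compact_imp_bounded compact_continuous_image) auto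
    show "r absolutely_integrable_on {0..T}"
      using r nonneg by (intro nonnegative_absolutely_integrable_1) auto
    show "{0..T} \<in> sets lebesgue"
      by simp
  qed
  from set_lebesgue_integral_eq_integral(1)[OF this] show ?thesis
    by (simp add: mult.commute)
qed

text \<open>
  The limit for one state: \<open>r\<close> is the rate of entering it and \<open>n\<close> its initial probability.
\<close>
lemma rate_exp_quotient_limit:
  fixes p q r :: "real \<Rightarrow> real"
  assumes "T > 0" and "t \<ge> 0"
    and per: "\<And>s. p (s + T) = p s" "\<And>s. q (s + T) = q s" "\<And>s. r (s + T) = r s"
    and nonneg: "\<And>s. p s \<ge> 0" "\<And>s. q s \<ge> 0" "\<And>s. r s \<ge> 0"
    and int: "p integrable_on {0..T}" "q integrable_on {0..T}" "r integrable_on {0..T}"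
    and "rate_exp p q T \<noteq> 1"
  shows "(\<lambda>N. (n + integral {0..real N * T + t} (\<lambda>s. r s * rate_exp p q s))
        / rate_exp p q (real N * T + t))
    \<longlonglongrightarrow> integral {0..t} (\<lambda>s. r s * rate_exp p q s) / rate_exp p q t
      + integral {0..T} (\<lambda>s. r s * rate_exp p q s) / (rate_exp p q t * (rate_exp p q T - 1))"
proof (rule affine_recursion_quotient_limit)
  have "integral {0..T} (\<lambda>u. p u + q u) \<ge> 0"
    using nonneg int by (intro integral_nonneg integrable_add) auto
  then have "rate_exp p q T \<ge> 1"
    by (simp add: rate_exp_def)
  with \<open>rate_exp p q T \<noteq> 1\<close> show "rate_exp p q T > 1"
    by simp
  show "rate_exp p q t \<noteq> 0"
    using rate_exp_pos[of p q t] by simp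
  show g: "rate_exp p q (s + T) = rate_exp p q T * rate_exp p q s" if "s \<ge> 0" for s
    using \<open>T > 0\<close> per(1,2) int(1,2) that by (rule rate_exp_add_period)
  show "integral {0..s + T} (\<lambda>s. r s * rate_exp p q s)
      = integral {0..T} (\<lambda>s. r s * rate_exp p q s)
        + rate_exp p q T * integral {0..s} (\<lambda>s. r s * rate_exp p q s)" if "s \<ge> 0" for s
    using int nonneg
    by (intro quasiperiodic_integral_shift[OF \<open>T > 0\<close> that] integrable_mult_rate_exp)
      (simp_all add: g per)
qed (use assms in auto)

theorem corollary3p9:
  fixes M :: "'a measure" and Y :: "real \<Rightarrow> 'a \<Rightarrow> int"
    and p q :: "real \<Rightarrow> real" and T t :: real
  assumes "T > 0"
    and "\<And>s. p (s + T) = p s" and "\<And>s. q (s + T) = q s"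
    and "p \<noteq> q"
    and "p integrable_on {0..T}" and "q integrable_on {0..T}"
    and "rate_exp p q T \<noteq> 1"
    and "two_state_chain M Y p q"
    and "\<And>s. s \<ge> 0 \<Longrightarrow> state_prob M Y (-1) s =
      (state_prob M Y (-1) 0 + integral {0..s} (\<lambda>r. q r * rate_exp p q r)) / rate_exp p q s"
    and "\<And>s. s \<ge> 0 \<Longrightarrow> state_prob M Y 1 s =
      (state_prob M Y 1 0 + integral {0..s} (\<lambda>r. p r * rate_exp p q r)) / rate_exp p q s"
    and "t \<ge> 0"
  shows "has_invariant_measure (state_prob M Y (-1)) T t
      (integral {0..t} (\<lambda>s. q s * rate_exp p q s) / rate_exp p q t
        + integral {0..T} (\<lambda>s. q s * rate_exp p q s) / (rate_exp p q t * (rate_exp p q T - 1)))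
    \<and> has_invariant_measure (state_prob M Y 1) T t
      (integral {0..t} (\<lambda>s. p s * rate_exp p q s) / rate_exp p q t
        + integral {0..T} (\<lambda>s. p s * rate_exp p q s) / (rate_exp p q t * (rate_exp p q T - 1)))"
proof -
  interpret two_state_chain M Y p q by fact
  have times: "real N * T + t \<ge> 0" for N
    using \<open>T > 0\<close> \<open>t \<ge> 0\<close> by simp
  show ?thesis
    unfolding has_invariant_measure_def assms(9,10)[OF times]
    using assms(1-7,11) rates_nonneg by (intro conjI rate_exp_quotient_limit) auto
qed

end
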